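(* Let $(\Omega,\mathcal{F},\lambda)$ be any measure space, $p\ge1$, and $f\in L^p(\Omega,\mathcal{F},\lambda)$. Then $$\|f\|_{L^p}=\inf\Bigl\{\inf\bigl\{c\,\|\Delta\circ|f|\|_{L^p}:c\in T_\Delta\bigr\}:\Delta\in\widetilde{\mathcal{Y}_{\mathrm{conc}}}\Bigr\}.$$
   Context: $\mathcal{Y}_{\mathrm{conc}}$ (the concave Young-functions) is the set of all functions $\Phi:[0,\infty)\to[0,\infty)$ of the form $\Phi(x)=\int_0^x\varphi(t)\,dt$, where $\varphi:(0,\infty)\to(0,\infty)$ is right-continuous, decreasing and integrable on every finite interval $(0,x)$, and $\Phi(\infty):=\lim_{x\to\infty}\Phi(x)=\infty$. Here "decreasing" is meant strictly, so every function in $\mathcal{Y}_{\mathrm{conc}}$ is strictly concave. $\widetilde{\mathcal{Y}_{\mathrm{conc}}}:=\{\Phi\in\mathcal{Y}_{\mathrm{conc}}:\lim_{t\to\infty}\Phi(t)/t>0\}$; equivalently, the set of $\Delta\in\mathcal{Y}_{\mathrm{conc}}$ for which there is $c\in[1,\infty)$ with $c\Delta(x)>x$ for all $x\in(0,\infty)$. For $\Delta\in\widetilde{\mathcal{Y}_{\mathrm{conc}}}$, $T_\Delta:=\{c\in[1,\infty):c\Delta(x)>x\text{ for all }x\in(0,\infty)\}$. *)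

theory Defs
  imports "HOL-Analysis.Analysis"
begin

text \<open>Functions on \<open>[0,\<infinity>)\<close> and \<open>(0,\<infinity>)\<close> are total functions of type \<^typ>\<open>real \<Rightarrow> real\<close>; their values
  outside these domains are left unconstrained and are never used.\<close>

definition concave_young_density :: "(real \<Rightarrow> real) \<Rightarrow> bool" where
  "concave_young_density \<phi> \<longleftrightarrow>
     (\<forall>t>0. \<phi> t > 0) \<and>
     (\<forall>t>0. continuous (at_right t) \<phi>) \<and>
     strict_antimono_on {0<..} \<phi> \<and>
     (\<forall>x>0. set_integrable lborel {0<..<x} \<phi>)"

definition Y_conc :: "(real \<Rightarrow> real) set" where
  "Y_conc = {\<Phi>. (\<exists>\<phi>. concave_young_density \<phi> \<and>
                       (\<forall>x\<ge>0. \<Phi> x = (LINT t:{0<..<x}|lborel. \<phi> t))) \<and>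
                filterlim \<Phi> at_top at_top}"

definition Y_conc_tilde :: "(real \<Rightarrow> real) set" where
  "Y_conc_tilde = {\<Phi> \<in> Y_conc. \<exists>L>0. ((\<lambda>t. \<Phi> t / t) \<longlongrightarrow> L) at_top}"

definition T_set :: "(real \<Rightarrow> real) \<Rightarrow> real set" where
  "T_set \<Delta> = {c. 1 \<le> c \<and> (\<forall>x>0. c * \<Delta> x > x)}"

text \<open>The norm takes values in \<open>[0,\<infinity>]\<close>: for \<open>f\<close> in \<open>L\<^sup>p\<close> and \<open>\<Delta>\<close> in \<^term>\<open>Y_conc_tilde\<close>
  the function \<open>\<Delta> \<circ> |f|\<close> need not be in \<open>L\<^sup>p\<close> (for instance when the derivative of \<open>\<Delta>\<close> is unbounded
  near \<open>0\<close> and the measure is infinite), and then its norm is \<open>\<infinity>\<close>. The second branch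
  below extends the \<open>1/p\<close>-th power to \<open>\<infinity>\<close>.\<close>

definition Lp_norm :: "real \<Rightarrow> 'a measure \<Rightarrow> ('a \<Rightarrow> 'b::real_normed_vector) \<Rightarrow> ennreal" where
  "Lp_norm p M f =
     (let I = (\<integral>\<^sup>+x. ennreal (norm (f x) powr p) \<partial>M)
      in if I < \<infinity> then ennreal (enn2real I powr (1 / p)) else \<infinity>)"

text \<open>Elements are functions rather than almost-everywhere classes.\<close>

definition Lp_space :: "real \<Rightarrow> 'a measure \<Rightarrow> ('a \<Rightarrow> 'b::real_normed_vector) set" where
  "Lp_space p M = {f \<in> borel_measurable M. Lp_norm p M f < \<infinity>}"

end

theory Submission
  imports Defs "HOL-Real_Asymp.Real_Asymp"
begin

text \<open>If \<open>c\<close> lies in \<open>T\<^sub>\<Delta>\<close> then \<open>|f| / c \<le> \<Delta> \<circ> |f|\<close> pointwise, so every number on the right is at least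
  the norm of \<open>f\<close>. Conversely, \<open>\<Delta>(x) = x + e (1 - exp (-x))\<close> lies strictly between \<open>x\<close> and \<open>(1 + e) x\<close>
  for \<open>x > 0\<close>, so \<open>c = 1\<close> is admissible and gives at most \<open>1 + e\<close> times the norm of \<open>f\<close>.\<close>

text \<open>Stated for arbitrary functions, so that it applies directly to
  \<open>\<Delta> \<circ> |f|\<close>.\<close>

lemma Lp_norm_mono:
  assumes "p > 0" and "\<And>x. x \<in> space M \<Longrightarrow> norm (f x) \<le> norm (g x)"
  shows "Lp_norm p M f \<le> Lp_norm p M g"
proof -
  have le: "(\<integral>\<^sup>+x. ennreal (norm (f x) powr p) \<partial>M) \<le> (\<integral>\<^sup>+x. ennreal (norm (g x) powr p) \<partial>M)"
    using assms by (intro nn_integral_mono ennreal_leI powr_mono2) auto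
  show ?thesis
    unfolding Lp_norm_def Let_def using le assms(1)
    by (auto intro!: ennreal_leI powr_mono2 enn2real_mono)
qed

lemma Lp_norm_scaleR:
  fixes f :: "'a \<Rightarrow> 'b::real_normed_vector"
  assumes "p > 0" "c > 0" and [measurable]: "f \<in> borel_measurable M"
  shows "Lp_norm p M (\<lambda>x. c *\<^sub>R f x) = ennreal c * Lp_norm p M f"
proof -
  define I where "I = (\<integral>\<^sup>+x. ennreal (norm (f x) powr p) \<partial>M)"
  have cI: "(\<integral>\<^sup>+x. ennreal (norm (c *\<^sub>R f x) powr p) \<partial>M) = ennreal (c powr p) * I"
    unfolding I_def using assms(2)
    by (subst nn_integral_cmult[symmetric]) (auto simp: powr_mult ennreal_mult)
  show ?thesis
  proof (cases "I < \<infinity>")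
    case True
    then have fin: "ennreal (c powr p) * I < \<infinity>"
      by (simp add: ennreal_mult_less_top)
    have "enn2real (ennreal (c powr p) * I) powr (1 / p) = c * enn2real I powr (1 / p)"
      using assms(1,2) by (simp add: enn2real_mult powr_mult powr_powr)
    then show ?thesis
      using True fin assms(2) unfolding Lp_norm_def cI I_def[symmetric]
      by (simp add: ennreal_mult)
  next
    \<comment> \<open>Since \<open>c powr p > 0\<close>, the factor leaves an infinite integral
      infinite, and both sides are \<open>\<infinity>\<close>.\<close>
    case False
    then have "I = \<infinity>" by (simp add: not_less top_unique)
    then show ?thesis
      using assms(2) unfolding Lp_norm_def cI I_def[symmetric]
      by (simp add: ennreal_mult_top)
  qed
qed

text \<open>The identity has constant derivative and so lies outside \<open>Y_conc\<close>. The
  added term turns the derivative into \<open>1 + e * exp (- x)\<close>, which is strictly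
  decreasing, stays above 1 and is at most \<open>1 + e\<close> on the half-line.\<close>

definition perturbed_id :: "real \<Rightarrow> real \<Rightarrow> real" where
  "perturbed_id e x = x + e * (1 - exp (- x))"

lemma perturbed_id_bounds:
  assumes "e > 0"
  shows "x > 0 \<Longrightarrow> x < perturbed_id e x" and "x \<ge> 0 \<Longrightarrow> perturbed_id e x \<le> (1 + e) * x"
    and "x \<ge> 0 \<Longrightarrow> 0 \<le> perturbed_id e x"
proof -
  have "1 - exp (- x) \<le> x"
    using exp_ge_add_one_self[of "- x"] by simp
  then have "e * (1 - exp (- x)) \<le> e * x"
    using assms by (intro mult_left_mono) auto
  then show "perturbed_id e x \<le> (1 + e) * x"
    by (simp add: perturbed_id_def algebra_simps)
qed (use assms in \<open>auto simp: perturbed_id_def\<close>)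

lemma perturbed_id_in_Y_conc_tilde:
  assumes "e > 0"
  shows "perturbed_id e \<in> Y_conc_tilde"
proof -
  define \<phi> :: "real \<Rightarrow> real" where "\<phi> t = 1 + e * exp (- t)" for t
  have cont: "continuous_on A \<phi>" for A
    unfolding \<phi>_def by (intro continuous_intros)
  \<comment> \<open>The density is continuous at 0 as well, so integrability on the open interval is
    inherited from the compact interval \<open>{0..x}\<close>.\<close>
  have int: "set_integrable lborel {0<..<x} \<phi>" for x
    by (rule set_integrable_subset[OF borel_integrable_compact[OF compact_Icc cont, of 0 x,
        folded set_integrable_def]]) auto
  have "concave_young_density \<phi>"
    unfolding concave_young_density_def
  proof (intro conjI allI impI int)
    show "\<phi> t > 0" for t
      using assms by (simp add: \<phi>_def add_pos_pos)
    show "continuous (at_right t) \<phi>" for t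
      unfolding \<phi>_def by (intro continuous_intros)
    show "strict_antimono_on {0<..} \<phi>"
      using assms by (auto simp: monotone_on_def \<phi>_def)
  qed
  moreover have "perturbed_id e x = (LINT t:{0<..<x}|lborel. \<phi> t)" if "x \<ge> 0" for x
  proof -
    \<comment> \<open>The boundary term at 0 vanishes, and for \<open>x \<ge> 0\<close> the interval
      integral is the set integral over \<open>{0<..<x}\<close>.\<close>
    have "(LBINT t=ereal 0..ereal x. \<phi> t) = perturbed_id e x - perturbed_id e 0"
    proof (rule interval_integral_FTC_finite[OF cont])
      show "(perturbed_id e has_vector_derivative \<phi> t) (at t within {min 0 x..max 0 x})" for t
        unfolding perturbed_id_def[abs_def] \<phi>_def has_real_derivative_iff_has_vector_derivative[symmetric]
        by (auto intro!: derivative_eq_intros)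
    qed
    then show ?thesis
      using that by (simp add: interval_lebesgue_integral_def perturbed_id_def)
  qed
  moreover have "filterlim (perturbed_id e) at_top at_top"
    unfolding perturbed_id_def[abs_def] using assms by real_asymp
  moreover have "((\<lambda>t. perturbed_id e t / t) \<longlongrightarrow> 1) at_top"
    unfolding perturbed_id_def using assms by real_asymp
  ultimately show ?thesis
    unfolding Y_conc_tilde_def Y_conc_def using zero_less_one by blast
qed

theorem theorem12:
  fixes M :: "'a measure" and p :: real and f :: "'a \<Rightarrow> 'b::real_normed_field"
  assumes "p \<ge> 1" and "f \<in> Lp_space p M"
  shows "Lp_norm p M f =
    (INF \<Delta>\<in>Y_conc_tilde. INF c\<in>T_set \<Delta>. ennreal c * Lp_norm p M (\<Delta> \<circ> (\<lambda>x. norm (f x))))"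
    (is "_ = ?R")
proof (rule antisym)
  have p: "p > 0" and meas: "f \<in> borel_measurable M" and fin: "Lp_norm p M f < \<infinity>"
    using assms by (auto simp: Lp_space_def)
  show "Lp_norm p M f \<le> ?R"
  proof (intro INF_greatest)
    fix \<Delta> c assume "\<Delta> \<in> Y_conc_tilde" and c: "c \<in> T_set \<Delta>"
    then have "c > 0" by (simp add: T_set_def)
    \<comment> \<open>The factor is put on \<open>f\<close>, whose measurability
      \<open>Lp_norm_scaleR\<close> requires, rather than on \<open>\<Delta> \<circ> |f|\<close>.
      Zeros of \<open>f\<close> are treated apart because \<open>T_set\<close> constrains
      \<open>\<Delta>\<close> only at positive arguments; there the left side is 0.\<close>
    have "norm ((1 / c) *\<^sub>R f x) \<le> norm ((\<Delta> \<circ> (\<lambda>x. norm (f x))) x)" for x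
    proof (cases "f x = 0")
      case False
      then have "norm (f x) < c * \<Delta> (norm (f x))"
        using c by (simp add: T_set_def)
      then show ?thesis
        using \<open>c > 0\<close> by (simp add: field_simps)
          (smt (verit, best) mult_left_mono)
    qed simp
    then have "Lp_norm p M (\<lambda>x. (1 / c) *\<^sub>R f x) \<le> Lp_norm p M (\<Delta> \<circ> (\<lambda>x. norm (f x)))"
      by (intro Lp_norm_mono p)
    then have "ennreal c * (ennreal (1 / c) * Lp_norm p M f)
        \<le> ennreal c * Lp_norm p M (\<Delta> \<circ> (\<lambda>x. norm (f x)))"
      using Lp_norm_scaleR[OF p _ meas, of "1 / c"] \<open>c > 0\<close> by (simp add: mult_left_mono)
    moreover have "ennreal c * (ennreal (1 / c) * Lp_norm p M f) = Lp_norm p M f"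
      using \<open>c > 0\<close> by (simp add: mult.assoc[symmetric] ennreal_mult[symmetric])
    ultimately show "Lp_norm p M f \<le> ennreal c * Lp_norm p M (\<Delta> \<circ> (\<lambda>x. norm (f x)))"
      by simp
  qed
  have le: "?R \<le> ennreal (1 + e) * Lp_norm p M f" if "e > 0" for e
  proof -
    have "1 \<in> T_set (perturbed_id e)"
      using perturbed_id_bounds(1)[OF that] by (simp add: T_set_def)
    then have "?R \<le> ennreal 1 * Lp_norm p M (perturbed_id e \<circ> (\<lambda>x. norm (f x)))"
      by (intro INF_lower2[OF perturbed_id_in_Y_conc_tilde[OF that]] INF_lower)
    \<comment> \<open>Nonnegativity of \<open>perturbed_id e\<close> removes the outer norm, so the
      upper bound applies pointwise with \<open>x = norm (f x)\<close>.\<close>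
    also have "\<dots> \<le> Lp_norm p M (\<lambda>x. (1 + e) *\<^sub>R f x)"
      using perturbed_id_bounds(2,3)[OF that] that by (auto intro!: Lp_norm_mono p)
    also have "\<dots> = ennreal (1 + e) * Lp_norm p M f"
      using that by (intro Lp_norm_scaleR p meas) simp
    finally show ?thesis .
  qed
  \<comment> \<open>The value \<open>e = 0\<close> would give the identity, which is not admissible,
    so the factor \<open>1 + e\<close> is removed by letting \<open>e\<close> tend to 0 from the
    right.\<close>
  have "((\<lambda>e. ennreal (1 + e) * Lp_norm p M f) \<longlongrightarrow> ennreal (1 + 0) * Lp_norm p M f) (at_right 0)"
    using fin by (intro tendsto_intros ennreal_tendsto_cmult tendsto_mult_ennreal) auto
  then show "?R \<le> Lp_norm p M f"
    using le by (intro tendsto_lowerbound[where F = "at_right (0::real)"])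
      (auto simp: eventually_at_right_less eventually_at_filter)
qed

end
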